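(* Every system of $n > 1$ point masses on the real line can be decomposed into at most $n-1$ systems of two point masses, all of which have the same center of mass as the original system.
   Context: A system of $n$ point masses on the real line consists of real numbers $a_1,\ldots,a_n$ (positions, not necessarily distinct) and positive numbers $m_1,\ldots,m_n$ (masses). Its center of mass is $\frac{m_1 a_1 + \cdots + m_n a_n}{m_1 + \cdots + m_n}$. A system is decomposed into finitely many systems if, for every real $x$, the total mass located at $x$ in the original system equals the sum, over the systems of the decomposition, of the total mass located at $x$ (so the mass of a point may be split among several point masses at the same position). *)

theory Defs
  imports Complex_Main
begin

text \<open>
  A system of \<open>n\<close> point masses is a list of \<open>n\<close> pairs (position, mass). Lists rather than sets are
  used because positions, and even whole point masses, may be repeated.
\<close>

type_synonym point_mass = "real \<times> real"

definition point_mass_system :: "nat \<Rightarrow> point_mass list \<Rightarrow> bool" where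
  "point_mass_system n S \<longleftrightarrow> length S = n \<and> (\<forall>(a, m)\<in>set S. m > 0)"

definition center_of_mass :: "point_mass list \<Rightarrow> real" where
  "center_of_mass S = (\<Sum>(a, m)\<leftarrow>S. m * a) / (\<Sum>(a, m)\<leftarrow>S. m)"

definition mass_at :: "point_mass list \<Rightarrow> real \<Rightarrow> real" where
  "mass_at S x = (\<Sum>(a, m)\<leftarrow>S. if a = x then m else 0)"

definition decomposes_into :: "point_mass list \<Rightarrow> point_mass list list \<Rightarrow> bool" where
  "decomposes_into S Ds \<longleftrightarrow> (\<forall>x. mass_at S x = (\<Sum>D\<leftarrow>Ds. mass_at D x))"

end

theory Submission imports Defs begin

text \<open>
  Let \<open>c\<close> be the center of mass and call \<open>m * (a - c)\<close> the moment of a point mass \<open>(a, m)\<close>. A system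
  has center of mass \<open>c\<close> exactly if its moments sum to zero, a condition that survives splitting off
  a subsystem that satisfies it. So it suffices to split off balanced pairs one at a time, each pair
  costing at least one point of the remaining system.

  A point lying at \<open>c\<close> is cut into two halves, which form such a pair. If no point lies at \<open>c\<close>, the
  vanishing total moment forces points on both sides of \<open>c\<close>. Take one from each side; the one with
  the smaller moment in absolute value is balanced by a suitable fraction of the other, so it can be
  used up entirely while the other loses part (or all) of its mass. The last two points form a
  balanced pair by themselves; taking both at once brings the count from \<open>n\<close> down to \<open>n - 1\<close>. When both points of a pair are used up, a single point
  can remain; it then lies at \<open>c\<close>. The induction in \<open>balanced_decomposition\<close> therefore also covers
  systems of fewer than two points.
\<close>

definition moment :: "real \<Rightarrow> point_mass list \<Rightarrow> real" where
  "moment c S = (\<Sum>(a, m)\<leftarrow>S. m * (a - c))"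

lemma moment_simps [simp]:
  "moment c [] = 0"
  "moment c ((a, m) # S) = m * (a - c) + moment c S"
  by (simp_all add: moment_def)

lemma mass_at_simps [simp]:
  "mass_at [] x = 0"
  "mass_at ((a, m) # S) x = (if a = x then m else 0) + mass_at S x"
  by (simp_all add: mass_at_def)

lemma moment_eq: "moment c S = (\<Sum>(a, m)\<leftarrow>S. m * a) - c * (\<Sum>(a, m)\<leftarrow>S. m)"
  by (induction S) (auto simp: algebra_simps)

lemma center_of_mass_eq_iff:
  assumes "S \<noteq> []" and "\<forall>(a, m)\<in>set S. m > 0"
  shows "center_of_mass S = c \<longleftrightarrow> moment c S = 0"
proof -
  have "(\<Sum>(a, m)\<leftarrow>S. m) > 0"
    using assms by (induction S rule: list_nonempty_induct) (auto intro: add_pos_pos)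
  then show ?thesis
    by (auto simp: center_of_mass_def moment_eq field_simps)
qed

lemma moment_remove1:
  assumes "(a, m) \<in> set S"
  shows "moment c S = m * (a - c) + moment c (remove1 (a, m) S)"
  using assms by (induction S) auto

lemma mass_at_remove1:
  assumes "(a, m) \<in> set S"
  shows "mass_at S x = (if a = x then m else 0) + mass_at (remove1 (a, m) S) x"
  using assms by (induction S) auto

lemma decomposes_into_Cons:
  assumes "decomposes_into S' Ds" and "\<And>x. mass_at S x = mass_at D x + mass_at S' x"
  shows "decomposes_into S (D # Ds)"
  using assms by (simp add: decomposes_into_def)

lemma moment_pos:
  assumes "S \<noteq> []" and "\<forall>(a, m)\<in>set S. m * (a - c) > 0"
  shows "moment c S > 0"
  using assms by (induction S rule: list_nonempty_induct) (auto intro: add_pos_pos)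

lemma moment_neg:
  assumes "S \<noteq> []" and "\<forall>(a, m)\<in>set S. m * (a - c) < 0"
  shows "moment c S < 0"
  using assms by (induction S rule: list_nonempty_induct) (auto intro: add_neg_neg)

text \<open>
  Of two points with moments of opposite sign, the one with the smaller moment in absolute value is
  named first, so that it is the one to be used up.
\<close>

lemma opposite_moments:
  assumes "S \<noteq> []" and "moment c S = 0" and "\<forall>(a, m)\<in>set S. m * (a - c) \<noteq> 0"
  obtains a m b k where "(a, m) \<in> set S" "(b, k) \<in> set S"
    "(m * (a - c)) * (k * (b - c)) < 0" "\<bar>m * (a - c)\<bar> \<le> \<bar>k * (b - c)\<bar>"
proof -
  obtain a m where 1: "(a, m) \<in> set S" "m * (a - c) < 0"
  proof -
    have "\<not> (\<forall>(a, m)\<in>set S. m * (a - c) > 0)"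
      using moment_pos[of S c] assms(1,2) by auto
    then show thesis using that assms(3) by (force simp: not_less less_le)
  qed
  obtain b k where 2: "(b, k) \<in> set S" "k * (b - c) > 0"
  proof -
    have "\<not> (\<forall>(a, m)\<in>set S. m * (a - c) < 0)"
      using moment_neg[of S c] assms(1,2) by auto
    then show thesis using that assms(3) by (force simp: not_less less_le)
  qed
  have "(m * (a - c)) * (k * (b - c)) < 0" "(k * (b - c)) * (m * (a - c)) < 0"
    using 1 2 by (auto intro: mult_neg_pos mult_pos_neg)
  then show thesis
    using that[OF 1(1) 2(1)] that[OF 2(1) 1(1)] by linarith
qed

text \<open>
  This is the reduction step: splitting off a balanced pair costs at least one point. Two points
  may disappear at once, namely when the moments of the chosen points cancel exactly; the remaining
  system is then one point shorter than in the generic case.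
\<close>

lemma split_off_balanced_pair:
  assumes nonempty: "S \<noteq> []" and pos: "\<forall>(a, m)\<in>set S. m > 0" and bal: "moment c S = 0"
  obtains D S' where "point_mass_system 2 D" "moment c D = 0"
    "\<forall>(a, m)\<in>set S'. m > 0" "moment c S' = 0" "length S' < length S"
    "\<And>x. mass_at S x = mass_at D x + mass_at S' x"
proof (cases "\<exists>m. (c, m) \<in> set S")
  case True
  then obtain m where m: "(c, m) \<in> set S" by blast
  let ?D = "[(c, m / 2), (c, m / 2)]" and ?S' = "remove1 (c, m) S"
  show thesis
  proof (rule that[of ?D ?S'])
    show "point_mass_system 2 ?D" using m pos by (auto simp: point_mass_system_def)
    show "\<forall>(a, m)\<in>set ?S'. m > 0" using pos set_remove1_subset by fastforce
    show "moment c ?S' = 0" using moment_remove1[OF m, of c] bal by simp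
    show "length ?S' < length S" using m nonempty by (simp add: length_remove1)
    show "mass_at S x = mass_at ?D x + mass_at ?S' x" for x
      using mass_at_remove1[OF m, of x] by simp
  qed simp
next
  case False
  have "\<forall>(a, m)\<in>set S. m * (a - c) \<noteq> 0"
    using False pos by fastforce
  then obtain a m b k where am: "(a, m) \<in> set S" and bk: "(b, k) \<in> set S"
    and opp: "(m * (a - c)) * (k * (b - c)) < 0" and le: "\<bar>m * (a - c)\<bar> \<le> \<bar>k * (b - c)\<bar>"
    using opposite_moments nonempty bal by metis
  have mpos: "m > 0" and kpos: "k > 0" using am bk pos by auto
  \<comment> \<open>The fraction of the second point whose moment cancels that of the first one.\<close>
  define t where "t = - (m * (a - c)) / (k * (b - c))"
  have t: "t > 0" "t \<le> 1" and cancel: "m * (a - c) + t * k * (b - c) = 0"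
  proof -
    show "t > 0"
      using opp by (auto simp: t_def mult_less_0_iff divide_less_0_iff)
    have "\<bar>t\<bar> \<le> 1"
      using opp le by (auto simp: t_def abs_divide divide_le_eq_1)
    then show "t \<le> 1" by simp
    have "t * (k * (b - c)) = - (m * (a - c))"
      using opp by (auto simp: t_def)
    then show "m * (a - c) + t * k * (b - c) = 0" by (simp add: mult.assoc)
  qed
  let ?D = "[(a, m), (b, t * k)]" and ?R = "remove1 (b, k) (remove1 (a, m) S)"
  define S' where "S' = (if t = 1 then ?R else (b, (1 - t) * k) # ?R)"
  have "(b, k) \<noteq> (a, m)"
    using opp by (auto simp: not_less)
  then have bk': "(b, k) \<in> set (remove1 (a, m) S)"
    using bk by (simp add: in_set_remove1)
  have len: "Suc (Suc (length ?R)) = length S"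
  proof -
    have "Suc (length (remove1 (a, m) S)) = length S"
      using am length_pos_if_in_set[OF am] by (simp add: length_remove1)
    moreover have "Suc (length ?R) = length (remove1 (a, m) S)"
      using bk' length_pos_if_in_set[OF bk'] by (simp add: length_remove1)
    ultimately show ?thesis by simp
  qed
  show thesis
  proof (rule that[of ?D S'])
    show "point_mass_system 2 ?D" using mpos kpos t by (simp add: point_mass_system_def)
    show "moment c ?D = 0" using cancel by simp
    have "\<forall>(a, m)\<in>set ?R. m > 0"
      using pos by (meson set_remove1_subset subset_iff)
    then show "\<forall>(a, m)\<in>set S'. m > 0" using t kpos by (auto simp: S'_def)
    show "moment c S' = 0"
      using moment_remove1[OF am, of c] moment_remove1[OF bk', of c] bal cancel
      by (auto simp: S'_def algebra_simps)
    show "length S' < length S" using len by (simp add: S'_def)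
    show "mass_at S x = mass_at ?D x + mass_at S' x" for x
      using mass_at_remove1[OF am, of x] mass_at_remove1[OF bk', of x]
      by (auto simp: S'_def algebra_simps)
  qed
qed

text \<open>
  The bound \<open>n - 1\<close> fails for a single point, which needs one pair. Such a system can arise only
  from a system of at least three points, and for these the reduction to one point is within the
  bound: one pair for the step, one for the remaining point.
\<close>

lemma balanced_decomposition:
  assumes "\<forall>(a, m)\<in>set S. m > 0" and "moment c S = 0"
  shows "\<exists>Ds. decomposes_into S Ds
    \<and> length Ds \<le> (if length S \<le> 1 then length S else length S - 1)
    \<and> (\<forall>D\<in>set Ds. point_mass_system 2 D \<and> moment c D = 0)"
  using assms
proof (induction "length S" arbitrary: S rule: less_induct)
  case less
  consider "S = []" | "length S = 2" | "S \<noteq> []" "length S \<noteq> 2" by blast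
  then show ?case
  proof cases
    case 1
    then show ?thesis by (intro exI[of _ "[]"]) (simp add: decomposes_into_def)
  next
    case 2
    then show ?thesis
      using less.prems
      by (intro exI[of _ "[S]"]) (simp add: decomposes_into_def point_mass_system_def)
  next
    case 3
    obtain D S' where D: "point_mass_system 2 D" "moment c D = 0"
      and S': "\<forall>(a, m)\<in>set S'. m > 0" "moment c S' = 0" "length S' < length S"
      and mass: "\<And>x. mass_at S x = mass_at D x + mass_at S' x"
      using split_off_balanced_pair[OF 3(1) less.prems] by metis
    obtain Ds where Ds: "decomposes_into S' Ds"
      "length Ds \<le> (if length S' \<le> 1 then length S' else length S' - 1)"
      "\<forall>D\<in>set Ds. point_mass_system 2 D \<and> moment c D = 0"
      using less.hyps[OF S'(3,1,2)] by blast
    have "length S \<noteq> 0" using 3 by simp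
    then have "length (D # Ds) \<le> (if length S \<le> 1 then length S else length S - 1)"
      using Ds(2) S'(3) 3(2) by (auto split: if_splits)
    then show ?thesis
      using decomposes_into_Cons[OF Ds(1) mass] D Ds(3)
      by (intro exI[of _ "D # Ds"]) auto
  qed
qed

theorem theorem2p3:
  fixes n :: nat and S :: "point_mass list"
  assumes "n > 1"
    and "point_mass_system n S"
  shows "\<exists>Ds. decomposes_into S Ds \<and> length Ds \<le> n - 1 \<and>
    (\<forall>D\<in>set Ds. point_mass_system 2 D \<and> center_of_mass D = center_of_mass S)"
proof -
  let ?c = "center_of_mass S"
  have len: "length S = n" and pos: "\<forall>(a, m)\<in>set S. m > 0"
    using assms(2) by (auto simp: point_mass_system_def)
  have "S \<noteq> []" using len assms(1) by auto
  then have "moment ?c S = 0"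
    using center_of_mass_eq_iff pos by blast
  then obtain Ds where Ds: "decomposes_into S Ds" "length Ds \<le> n - 1"
    "\<forall>D\<in>set Ds. point_mass_system 2 D \<and> moment ?c D = 0"
    using balanced_decomposition[OF pos, of ?c] len assms(1) by auto
  have "center_of_mass D = ?c" if "D \<in> set Ds" for D
  proof -
    have "D \<noteq> []" "\<forall>(a, m)\<in>set D. m > 0" "moment ?c D = 0"
      using Ds(3) that by (auto simp: point_mass_system_def)
    then show ?thesis using center_of_mass_eq_iff by blast
  qed
  then show ?thesis using Ds by blast
qed

end
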